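(* If Sullivan's conjecture is false (i.e. if there exists at least one counterexample to it), then there exists $\epsilon>0$ such that for every $k\in\mathbb{N}$ there exists a strongly connected orientation $O$ with minimum out-degree at least $k$ such that no vertex $v$ of $O$ satisfies $|N^+_2(O,v)|\ge(1-\epsilon)|N^-_1(O,v)|$.
   Context: All directed graphs are finite, with non-empty vertex set, and without loops or multiple arcs. An orientation (oriented graph) is a directed graph with no directed cycle of length 2. For a directed graph $G$ and $v\in V(G)$: $N^+_1(G,v)=\{w : (v,w)\in E(G)\}$, $N^-_1(G,v)=\{u : (u,v)\in E(G)\}$, and $N^+_2(G,v)=\{w\in V(G)\setminus(N^+_1(G,v)\cup\{v\}) : \exists u\in N^+_1(G,v),\ (u,w)\in E(G)\}$. Sullivan's conjecture states that every oriented graph $G$ contains a vertex $v$ with $|N^+_2(G,v)|\ge|N^-_1(G,v)|$. A counterexample is an orientation $G$ with $|N^+_2(G,v)|<|N^-_1(G,v)|$ for all $v\in V(G)$. The minimum out-degree of $O$ is $\min_v|N^+_1(O,v)|$. A directed graph is strongly connected if for any two vertices $u,v$ there are directed walks from $u$ to $v$ and from $v$ to $u$. *)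

theory Defs
  imports
    Complex_Main
    "Graph_Theory.Pair_Digraph"
    "Graph_Theory.Digraph_Component"
begin

text \<open>
  In a \<^typ>\<open>'a pair_pre_digraph\<close> arcs are pairs of vertices, so multiple arcs are excluded by
  construction; \<^const>\<open>pair_digraph\<close> adds finiteness and the absence of loops, but it admits the
  null graph. As loops are excluded, the last conjunct says that there is no directed cycle of
  length 2.
\<close>

definition oriented_graph :: "'a pair_pre_digraph \<Rightarrow> bool" where
  "oriented_graph G \<longleftrightarrow> pair_digraph G \<and> pverts G \<noteq> {} \<and>
     (\<forall>u v. (u, v) \<in> parcs G \<longrightarrow> (v, u) \<notin> parcs G)"

definition out_nbrs1 :: "'a pair_pre_digraph \<Rightarrow> 'a \<Rightarrow> 'a set" where
  "out_nbrs1 G v = {w. (v, w) \<in> parcs G}"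

definition in_nbrs1 :: "'a pair_pre_digraph \<Rightarrow> 'a \<Rightarrow> 'a set" where
  "in_nbrs1 G v = {u. (u, v) \<in> parcs G}"

definition out_nbrs2 :: "'a pair_pre_digraph \<Rightarrow> 'a \<Rightarrow> 'a set" where
  "out_nbrs2 G v =
     {w \<in> pverts G - (out_nbrs1 G v \<union> {v}). \<exists>u \<in> out_nbrs1 G v. (u, w) \<in> parcs G}"

definition sullivan_counterexample :: "'a pair_pre_digraph \<Rightarrow> bool" where
  "sullivan_counterexample G \<longleftrightarrow> oriented_graph G \<and>
     (\<forall>v \<in> pverts G. card (out_nbrs2 G v) < card (in_nbrs1 G v))"

definition min_out_degree :: "'a pair_pre_digraph \<Rightarrow> nat" where
  "min_out_degree G = Min ((\<lambda>v. card (out_nbrs1 G v)) ` pverts G)"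

end

theory Submission
  imports Defs
begin

text \<open>
  A strong component without incoming arcs keeps all its in-neighbours and gains no second
  out-neighbours, so a counterexample may be assumed strongly connected. Replacing every vertex
  by \<open>k\<close> independent copies multiplies all the neighbourhood sizes by \<open>k\<close>: since there are no
  2-cycles, a copy of \<open>v\<close> is never a second out-neighbour of another copy of \<open>v\<close>. So the ratios
  are unchanged, and they are bounded away from 1 because there are finitely many of them.
\<close>

section \<open>Induced subgraphs, pullbacks and working criteria\<close>

definition induced :: "'a pair_pre_digraph \<Rightarrow> 'a set \<Rightarrow> 'a pair_pre_digraph" where
  "induced G S = \<lparr>pverts = S, parcs = parcs G \<inter> S \<times> S\<rparr>"

text \<open>If \<open>p\<close> maps \<open>V\<close> onto the vertices of a loopless
  \<open>G\<close> with all fibres of size \<open>k\<close>, this is the blow-up of \<open>G\<close>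
  in which vertices become independent sets of size \<open>k\<close>. Describing it by a projection
  leaves the type of the copies free and turns neighbourhoods into preimages.\<close>

definition pullback :: "('b \<Rightarrow> 'a) \<Rightarrow> 'b set \<Rightarrow> 'a pair_pre_digraph \<Rightarrow> 'b pair_pre_digraph" where
  "pullback p V G = \<lparr>pverts = V, parcs = {(x, y). x \<in> V \<and> y \<in> V \<and> (p x, p y) \<in> parcs G}\<rparr>"

text \<open>The case \<open>u = v\<close> of the condition on 2-cycles already excludes loops, and
  finitely many vertices leave room for finitely many arcs only.\<close>

lemma oriented_graph_iff:
  "oriented_graph G \<longleftrightarrow> finite (pverts G) \<and> pverts G \<noteq> {} \<and> parcs G \<subseteq> pverts G \<times> pverts G \<and>
     (\<forall>u v. (u, v) \<in> parcs G \<longrightarrow> (v, u) \<notin> parcs G)"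
proof -
  have "pair_digraph G \<longleftrightarrow> finite (pverts G) \<and> parcs G \<subseteq> pverts G \<times> pverts G"
    if "\<forall>u v. (u, v) \<in> parcs G \<longrightarrow> (v, u) \<notin> parcs G"
  proof
    assume "pair_digraph G"
    then interpret pair_digraph G .
    show "finite (pverts G) \<and> parcs G \<subseteq> pverts G \<times> pverts G"
      using in_arcsD1 in_arcsD2 by auto
  next
    assume *: "finite (pverts G) \<and> parcs G \<subseteq> pverts G \<times> pverts G"
    then have "finite (parcs G)"
      by (meson finite_SigmaI finite_subset)
    with * show "pair_digraph G"
      using that by unfold_locales (auto, metis)
  qed
  then show ?thesis
    unfolding oriented_graph_def by blast
qed

lemma strongly_connected_if_trancl:
  assumes "oriented_graph G" and "\<And>u v. u \<in> pverts G \<Longrightarrow> v \<in> pverts G \<Longrightarrow> (u, v) \<in> (parcs G)\<^sup>+"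
  shows "strongly_connected (with_proj G)"
proof -
  interpret pair_digraph G
    using assms(1) unfolding oriented_graph_def by blast
  have "u \<rightarrow>\<^sup>*\<^bsub>with_proj G\<^esub> v" if "u \<in> pverts G" "v \<in> pverts G" for u v
    using assms(2)[OF that] by (rule reachable1_reachable)
  then show ?thesis
    using assms(1) unfolding strongly_connected_def oriented_graph_def by simp
qed

section \<open>Reduction to a strongly connected counterexample\<close>

lemma oriented_graph_induced:
  assumes "oriented_graph G" "S \<subseteq> pverts G" "S \<noteq> {}"
  shows "oriented_graph (induced G S)"
  using assms finite_subset[of S "pverts G"]
  unfolding oriented_graph_iff induced_def pair_pre_digraph.select_convs by blast

text \<open>No arc enters \<open>S\<close> from outside, so in-neighbourhoods within
  \<open>S\<close> stay the same. Second out-neighbourhoods can only shrink, since adjacency inside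
  \<open>S\<close> is that of \<open>G\<close>.\<close>

lemma counterexample_induced:
  assumes G: "sullivan_counterexample G" and S: "S \<subseteq> pverts G" "S \<noteq> {}"
    and closed: "\<And>u v. (u, v) \<in> parcs G \<Longrightarrow> v \<in> S \<Longrightarrow> u \<in> S"
  shows "sullivan_counterexample (induced G S)"
  unfolding sullivan_counterexample_def
proof (intro conjI ballI)
  have G': "oriented_graph G"
    using G by (simp add: sullivan_counterexample_def)
  then show "oriented_graph (induced G S)"
    using S by (rule oriented_graph_induced)
  fix v assume "v \<in> pverts (induced G S)"
  then have v: "v \<in> S"
    by (simp add: induced_def)
  have "finite (out_nbrs2 G v)"
    using G' by (simp add: out_nbrs2_def oriented_graph_iff)
  moreover have "out_nbrs2 (induced G S) v \<subseteq> out_nbrs2 G v"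
    using v S by (auto simp: out_nbrs2_def out_nbrs1_def induced_def)
  ultimately have "card (out_nbrs2 (induced G S) v) \<le> card (out_nbrs2 G v)"
    by (rule card_mono)
  also have "\<dots> < card (in_nbrs1 G v)"
    using G v S by (auto simp: sullivan_counterexample_def)
  also have "in_nbrs1 G v = in_nbrs1 (induced G S) v"
    using v closed by (auto simp: in_nbrs1_def induced_def)
  finally show "card (out_nbrs2 (induced G S) v) < card (in_nbrs1 (induced G S) v)" .
qed

lemma in_neighbour_in_counterexample:
  assumes "sullivan_counterexample G" "v \<in> pverts G"
  obtains u where "(u, v) \<in> parcs G"
proof -
  have "card (in_nbrs1 G v) > 0"
    using assms by (auto simp: sullivan_counterexample_def)
  then show thesis
    using that by (metis card.empty equals0I in_nbrs1_def less_irrefl mem_Collect_eq)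
qed

text \<open>The set of ancestors of a vertex is closed under predecessors; one of least size is a
  strong component without incoming arcs. The conclusion asks for non-empty walks, also from a
  vertex to itself, because distinct copies of one vertex must later be joined.\<close>

lemma strongly_connected_counterexample:
  fixes G :: "'a pair_pre_digraph"
  assumes G: "sullivan_counterexample G"
  obtains H :: "'a pair_pre_digraph" where "sullivan_counterexample H"
    "\<And>u v. u \<in> pverts H \<Longrightarrow> v \<in> pverts H \<Longrightarrow> (u, v) \<in> (parcs H)\<^sup>+"
proof -
  define A where "A v = {u. (u, v) \<in> (parcs G)\<^sup>*}" for v
  have oG: "finite (pverts G)" "pverts G \<noteq> {}" "parcs G \<subseteq> pverts G \<times> pverts G"
    using G by (auto simp: sullivan_counterexample_def oriented_graph_iff)
  have A_sub: "A v \<subseteq> pverts G" if "v \<in> pverts G" for v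
    using that oG(3) by (auto simp: A_def elim: converse_rtranclE)
  obtain r where r: "r \<in> pverts G" and r_min: "\<And>v. v \<in> pverts G \<Longrightarrow> card (A r) \<le> card (A v)"
    using oG ex_is_arg_min_if_finite[of "pverts G" "\<lambda>v. card (A v)"]
    by (auto simp: is_arg_min_linorder)
  define S where "S = A r"
  define H where "H = induced G S"
  have S: "S \<subseteq> pverts G" "S \<noteq> {}"
    using A_sub[OF r] by (auto simp: S_def A_def)
  have closed: "u \<in> S" if "(u, v) \<in> parcs G" "v \<in> S" for u v
    using that by (auto simp: S_def A_def)
  \<comment> \<open>An ancestor \<open>v\<close> of \<open>r\<close> has all its ancestors among
    those of \<open>r\<close>; minimality forces equality, and \<open>r\<close> is an ancestor of
    itself.\<close>
  have from_r: "(r, v) \<in> (parcs G)\<^sup>*" if "v \<in> S" for v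
  proof -
    have "A v \<subseteq> A r"
      using that by (auto simp: S_def A_def)
    moreover have "finite (A r)"
      using S oG finite_subset unfolding S_def by blast
    moreover have "card (A r) \<le> card (A v)"
      using that S r_min by blast
    ultimately have "A v = A r"
      by (intro card_seteq)
    then show ?thesis
      by (auto simp: A_def)
  qed
  \<comment> \<open>A walk of \<open>G\<close> that ends in \<open>S\<close> never leaves
    \<open>S\<close>, so it is a walk of \<open>H\<close>.\<close>
  have stay: "u \<in> S \<and> (u, v) \<in> (parcs H)\<^sup>*" if "(u, v) \<in> (parcs G)\<^sup>*" "v \<in> S" for u v
    using that
  proof (induction rule: converse_rtrancl_induct)
    case (step x y)
    then have "(x, y) \<in> parcs H" "x \<in> S"
      using closed by (auto simp: H_def induced_def)
    with step show ?case
      by (auto intro: converse_rtrancl_into_rtrancl)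
  qed auto
  have H: "sullivan_counterexample H"
    unfolding H_def using G S closed by (rule counterexample_induced)
  show thesis
  proof (rule that[OF H])
    fix u v assume "u \<in> pverts H" "v \<in> pverts H"
    then have "u \<in> S"
      by (simp add: H_def induced_def)
    \<comment> \<open>Ending the walk with an arc into \<open>v\<close> makes it non-empty even when
      \<open>u = v\<close>.\<close>
    obtain w where w: "(w, v) \<in> parcs H"
      using in_neighbour_in_counterexample[OF H \<open>v \<in> pverts H\<close>] .
    then have "w \<in> S"
      by (simp add: H_def induced_def)
    with \<open>u \<in> S\<close> from_r have "(u, w) \<in> (parcs G)\<^sup>*"
      by (metis A_def S_def mem_Collect_eq rtrancl_trans)
    with \<open>w \<in> S\<close> stay have "(u, w) \<in> (parcs H)\<^sup>*"
      by blast
    with w show "(u, v) \<in> (parcs H)\<^sup>+"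
      by simp
  qed
qed

section \<open>Blow-ups as pullbacks\<close>

lemma oriented_graph_pullback:
  assumes "oriented_graph G" "finite V" "V \<noteq> {}"
  shows "oriented_graph (pullback p V G)"
  using assms unfolding oriented_graph_iff pullback_def pair_pre_digraph.select_convs by blast

text \<open>A walk lifts arc by arc, with any choice of preimages for its later vertices. If
  \<open>p x = p y\<close>, a closed walk of \<open>G\<close> lifts to a walk between two
  copies.\<close>

lemma pullback_trancl:
  assumes surj: "p ` V = pverts G" and arcs: "parcs G \<subseteq> pverts G \<times> pverts G"
    and "x \<in> V" "y \<in> V" "(p x, p y) \<in> (parcs G)\<^sup>+"
  shows "(x, y) \<in> (parcs (pullback p V G))\<^sup>+"
proof -
  \<comment> \<open>The induction reaches the whole fibre over \<open>b\<close>, so the next arc may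
    start from any preimage.\<close>
  have "\<forall>y \<in> V. p y = b \<longrightarrow> (x, y) \<in> (parcs (pullback p V G))\<^sup>+" if "(p x, b) \<in> (parcs G)\<^sup>+" for b
    using that
  proof (induction rule: trancl_induct)
    case (base b)
    then show ?case
      using \<open>x \<in> V\<close> by (auto simp: pullback_def)
  next
    case (step b c)
    then have "b \<in> p ` V"
      using surj arcs by blast
    then obtain z where "z \<in> V" "p z = b"
      by blast
    with step have "(x, z) \<in> (parcs (pullback p V G))\<^sup>+"
      by blast
    moreover have "(z, y) \<in> parcs (pullback p V G)" if "y \<in> V" "p y = c" for y
      using that step \<open>z \<in> V\<close> \<open>p z = b\<close> by (simp add: pullback_def)
    ultimately show ?case
      by (blast intro: trancl_into_trancl)
  qed
  then show ?thesis
    using assms by blast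
qed

lemma nbrs_pullback:
  assumes "x \<in> V"
  shows "out_nbrs1 (pullback p V G) x = p -` out_nbrs1 G (p x) \<inter> V"
    and "in_nbrs1 (pullback p V G) x = p -` in_nbrs1 G (p x) \<inter> V"
  using assms by (auto simp: pullback_def out_nbrs1_def in_nbrs1_def)

lemma out_nbrs2_pullback:
  assumes "x \<in> V" "oriented_graph G" "p ` V = pverts G"
  shows "out_nbrs2 (pullback p V G) x \<subseteq> p -` out_nbrs2 G (p x) \<inter> V"
proof
  fix y assume y: "y \<in> out_nbrs2 (pullback p V G) x"
  then obtain z where "y \<in> V" "(p x, p z) \<in> parcs G" "(p z, p y) \<in> parcs G"
    by (auto simp: out_nbrs2_def out_nbrs1_def pullback_def)
  \<comment> \<open>Equality would make the arcs through \<open>p z\<close> a 2-cycle of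
    \<open>G\<close>; this is where orientedness enters.\<close>
  moreover from this have "p y \<noteq> p x"
    using assms(2) unfolding oriented_graph_iff by metis
  moreover have "(p x, p y) \<notin> parcs G"
    using y assms(1) by (auto simp: out_nbrs2_def out_nbrs1_def pullback_def)
  ultimately show "y \<in> p -` out_nbrs2 G (p x) \<inter> V"
    using assms(3) by (auto simp: out_nbrs2_def out_nbrs1_def)
qed

text \<open>The pairs in \<open>S \<times> {..<k}\<close> are numbered by naturals and projected to
  their first component, so the blow-up has vertices in \<open>nat\<close> whatever the type
  \<open>'a\<close> is.\<close>

lemma ex_equal_fibres:
  assumes "finite S" "k > 0"
  obtains p :: "nat \<Rightarrow> 'a" and V :: "nat set" where "finite V" "p ` V = S"
    "\<And>A. A \<subseteq> S \<Longrightarrow> card (p -` A \<inter> V) = k * card A"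
proof -
  define N where "N = card (S \<times> {..<k})"
  obtain h where h: "bij_betw h {0..<N} (S \<times> {..<k})"
    using ex_bij_betw_nat_finite[of "S \<times> {..<k}"] assms(1) unfolding N_def by auto
  show thesis
  proof (rule that[of "{0..<N}" "fst \<circ> h"])
    have "(fst \<circ> h) ` {0..<N} = fst ` (S \<times> {..<k})"
      unfolding image_comp[symmetric] bij_betw_imp_surj_on[OF h] ..
    also have "\<dots> = S"
      using assms(2) by (auto simp: fst_image_times)
    finally show "(fst \<circ> h) ` {0..<N} = S" .
    fix A assume "A \<subseteq> S"
    have "h ` ((fst \<circ> h) -` A \<inter> {0..<N}) = fst -` A \<inter> h ` {0..<N}"
      by auto
    also have "\<dots> = A \<times> {..<k}"
      unfolding bij_betw_imp_surj_on[OF h] using \<open>A \<subseteq> S\<close> by auto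
    finally have "h ` ((fst \<circ> h) -` A \<inter> {0..<N}) = A \<times> {..<k}" .
    moreover have "inj_on h ((fst \<circ> h) -` A \<inter> {0..<N})"
      using h by (auto simp: bij_betw_def intro: inj_on_subset)
    ultimately have "card ((fst \<circ> h) -` A \<inter> {0..<N}) = card (A \<times> {..<k})"
      by (metis card_image)
    then show "card ((fst \<circ> h) -` A \<inter> {0..<N}) = k * card A"
      by (simp add: card_cartesian_product mult.commute)
  qed simp
qed

theorem corollary6p10:
  assumes "\<exists>G :: 'a pair_pre_digraph. sullivan_counterexample G"
  shows "\<exists>\<epsilon>::real. \<epsilon> > 0 \<and>
    (\<forall>k::nat. \<exists>H :: nat pair_pre_digraph.
       oriented_graph H \<and> strongly_connected (with_proj H) \<and> min_out_degree H \<ge> k \<and>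
       \<not> (\<exists>v \<in> pverts H.
            real (card (out_nbrs2 H v)) \<ge> (1 - \<epsilon>) * real (card (in_nbrs1 H v))))"
proof -
  obtain G' :: "'a pair_pre_digraph" where "sullivan_counterexample G'"
    using assms ..
  then obtain G :: "'a pair_pre_digraph" where G: "sullivan_counterexample G"
    and conn: "\<And>u v. u \<in> pverts G \<Longrightarrow> v \<in> pverts G \<Longrightarrow> (u, v) \<in> (parcs G)\<^sup>+"
    by (rule strongly_connected_counterexample) blast
  have oG: "oriented_graph G"
    using G by (simp add: sullivan_counterexample_def)
  then have fin: "finite (pverts G)" and arcs: "parcs G \<subseteq> pverts G \<times> pverts G"
    and ne: "pverts G \<noteq> {}"
    by (simp_all only: oriented_graph_iff not_False_eq_True)
  have nbrs_sub: "out_nbrs1 G v \<subseteq> pverts G" "in_nbrs1 G v \<subseteq> pverts G" "out_nbrs2 G v \<subseteq> pverts G" for v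
    using arcs by (auto simp: out_nbrs1_def in_nbrs1_def out_nbrs2_def)
  \<comment> \<open>A non-empty closed walk at \<open>v\<close> starts with an arc leaving
    \<open>v\<close>.\<close>
  have out_pos: "card (out_nbrs1 G v) \<ge> 1" if "v \<in> pverts G" for v
  proof -
    have "out_nbrs1 G v \<noteq> {}"
      using conn[OF that that] by (auto simp: out_nbrs1_def dest: tranclD)
    moreover have "finite (out_nbrs1 G v)"
      using nbrs_sub(1) fin by (rule finite_subset)
    ultimately show ?thesis
      by (simp add: Suc_le_eq card_gt_0_iff)
  qed
  \<comment> \<open>In-degrees are at most \<open>card (pverts G)\<close>; the added 1 makes
    \<open>\<epsilon>\<close> times an in-degree strictly less than 1, the least gap between the two
    integer cardinalities in a counterexample.\<close>
  define \<epsilon> where "\<epsilon> = 1 / real (card (pverts G) + 1)"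
  have ratio: "real (card (out_nbrs2 G v)) < (1 - \<epsilon>) * real (card (in_nbrs1 G v))"
    if "v \<in> pverts G" for v
  proof -
    have "card (in_nbrs1 G v) < card (pverts G) + 1"
      using card_mono[OF fin nbrs_sub(2)] by (simp add: less_Suc_eq_le)
    then have "\<epsilon> * real (card (in_nbrs1 G v)) < 1"
      by (simp add: \<epsilon>_def field_simps)
    moreover have "real (card (out_nbrs2 G v)) + 1 \<le> real (card (in_nbrs1 G v))"
      using G that by (force simp: sullivan_counterexample_def)
    ultimately show ?thesis
      by (simp add: algebra_simps)
  qed
  have "\<exists>H :: nat pair_pre_digraph.
       oriented_graph H \<and> strongly_connected (with_proj H) \<and> min_out_degree H \<ge> k \<and>
       \<not> (\<exists>v \<in> pverts H.
            real (card (out_nbrs2 H v)) \<ge> (1 - \<epsilon>) * real (card (in_nbrs1 H v)))" for k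
  proof -
    \<comment> \<open>Taking \<open>Suc k\<close> copies keeps the fibres non-empty when
      \<open>k = 0\<close>. As out-degrees in \<open>G\<close> are at least 1, those in the blow-up
      are at least \<open>Suc k\<close>.\<close>
    obtain p :: "nat \<Rightarrow> 'a" and V where V: "finite V" and pV: "p ` V = pverts G"
      and fibres: "\<And>A. A \<subseteq> pverts G \<Longrightarrow> card (p -` A \<inter> V) = Suc k * card A"
      by (rule ex_equal_fibres[OF fin, of "Suc k"]) auto
    define H where "H = pullback p V G"
    have vH: "pverts H = V" and V_ne: "V \<noteq> {}"
      using pV ne by (auto simp: H_def pullback_def)
    have oH: "oriented_graph H"
      unfolding H_def using oG V V_ne by (rule oriented_graph_pullback)
    moreover have "strongly_connected (with_proj H)"
    proof (rule strongly_connected_if_trancl[OF oH])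
      fix x y assume "x \<in> pverts H" "y \<in> pverts H"
      then show "(x, y) \<in> (parcs H)\<^sup>+"
        unfolding vH unfolding H_def using pullback_trancl[OF pV arcs] conn pV by blast
    qed
    moreover have "min_out_degree H \<ge> k"
    proof -
      have "card (out_nbrs1 H x) \<ge> k" if "x \<in> V" for x
      proof -
        have "card (out_nbrs1 H x) = Suc k * card (out_nbrs1 G (p x))"
          unfolding H_def nbrs_pullback(1)[OF that] using nbrs_sub(1) by (rule fibres)
        moreover have "card (out_nbrs1 G (p x)) \<ge> 1"
          using that pV out_pos by blast
        ultimately have "card (out_nbrs1 H x) \<ge> Suc k * 1"
          by (simp only: mult_le_mono2)
        then show ?thesis
          by simp
      qed
      then show ?thesis
        using V V_ne by (simp add: min_out_degree_def vH)
    qed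
    moreover have "real (card (out_nbrs2 H x)) < (1 - \<epsilon>) * real (card (in_nbrs1 H x))"
      if "x \<in> V" for x
    proof -
      have "card (out_nbrs2 H x) \<le> card (p -` out_nbrs2 G (p x) \<inter> V)"
        unfolding H_def using V out_nbrs2_pullback[OF that oG pV] by (intro card_mono) auto
      also have "\<dots> = Suc k * card (out_nbrs2 G (p x))"
        using nbrs_sub(3) by (rule fibres)
      \<comment> \<open>Both sides of the inequality for \<open>G\<close> scale by the same factor
        \<open>Suc k\<close>, so the same \<open>\<epsilon>\<close> serves every
        \<open>k\<close>.\<close>
      finally have "real (card (out_nbrs2 H x)) \<le> real (Suc k) * real (card (out_nbrs2 G (p x)))"
        unfolding of_nat_mult[symmetric] by (rule of_nat_mono)
      also have "\<dots> < real (Suc k) * ((1 - \<epsilon>) * real (card (in_nbrs1 G (p x))))"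
        using that pV ratio by (intro mult_strict_left_mono) auto
      also have "\<dots> = (1 - \<epsilon>) * real (card (in_nbrs1 H x))"
        unfolding H_def nbrs_pullback(2)[OF that] fibres[OF nbrs_sub(2)] by (simp add: algebra_simps)
      finally show ?thesis .
    qed
    ultimately show ?thesis
      by (intro exI[of _ H]) (auto simp: vH not_le)
  qed
  moreover have "\<epsilon> > 0"
    by (simp add: \<epsilon>_def)
  ultimately show ?thesis
    by blast
qed

end
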